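(* Let $\mathbf{L}$ be either $\mathbf{P}[\bot]$ or $\mathbf{P}[\bot_w]$, let $\Gamma$ be a set of infons and $\varphi$ an infon. Then $\Gamma\vdash\varphi$ in $\mathbf{L}$ if and only if $v(\varphi)\in M$ for every model $\langle I,M\rangle$ of $\mathbf{L}$ (where $I=\langle\mathcal A,v\rangle$) with $v(\Gamma)\subseteq M$.
   Context: Infons: fix a set $At$ of atomic infons; infons are generated by $\varphi ::= \top\mid\bot \mid At \mid (\varphi\wedge\varphi)\mid(\varphi\to\varphi)$. Basic rules: from $\varphi_1,\varphi_2$ infer $\varphi_1\wedge\varphi_2$; from $\varphi_1\wedge\varphi_2$ infer $\varphi_i$ ($i=1,2$); from $\varphi_2$ infer $\varphi_1\to\varphi_2$; from $\varphi_1$ and $\varphi_1\to\varphi_2$ infer $\varphi_2$. $\mathbf{P}[\bot]$ adds: from $\bot$ infer any $\varphi$. $\mathbf{P}[\bot_w]$ instead adds: from $\bot$ and $\varphi\to\psi$ infer $\psi$. In $\mathbf{L}$, $\Gamma\vdash\varphi$ iff there is a finite sequence ending in $\varphi$ whose members are in $\Gamma\cup\{\top\}$ or follow from earlier members by the rules of $\mathbf{L}$. Infon algebras: $\Sigma=\{0,1\}$, $\mathsf f\notin\Sigma$, $\Sigma_\bot=\Sigma\cup\{\mathsf f\}$. $\mathcal A=\langle\Sigma_\bot^*,\pi,l,r,\mathrm{enc},\mathrm{dec},E\rangle$ with $\pi,\mathrm{enc}:(\Sigma_\bot^* )^2\to\Sigma_\bot^*$ total, $l,r,\mathrm{dec}$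 partial, $l(\pi(x,y))=x$, $r(\pi(x,y))=y$, $\mathrm{dec}(x,\mathrm{enc}(x,y))=y$ defined and valid for all $x,y$, all functions mapping arguments in $\Sigma^*$ to values in $\Sigma^*$, and $\emptyset\ne E\subseteq\Sigma^*$; for $\mathbf{P}[\bot_w]$ there is additionally a partial operation $\mathrm{crack}$ with $\mathrm{crack}(\mathsf f,\mathrm{enc}(a,b))=b$. An interpretation is $I=\langle\mathcal A,v\rangle$ with $v:At\cup\{\top,\bot\}\to\Sigma_\bot^*$, $v(\bot)=\mathsf f$, $v(\top)\in E$, $v(p)\in\Sigma^*$ for $p\in At$, extended by $v(\varphi_1\wedge\varphi_2)=\pi(v(\varphi_1),v(\varphi_2))$, $v(\varphi_1\to\varphi_2)=\mathrm{enc}(v(\varphi_1),v(\varphi_2))$, $v(\Gamma)=\{v(\psi):\psi\in\Gamma\}$. $M\subseteq\Sigma_\bot^*$ is $\mathbf{L}$-closed if $E\subseteq M$ and for all $a,b\in\Sigma_\bot^*$: (1) $a,b\in M\iff\pi(a,b)\in M$; (2) $a,\mathrm{enc}(a,b)\in M\Rightarrow b\in M$; (3) $b\in M\Rightarrow\mathrm{enc}(a,b)\in M$; for $\mathbf{P}[\bot]$: (4) $\mathsf f\in M$ implies $M=\Sigma_\bot^*$; for $\mathbf{P}[\bot_w]$: (4') $\mathsf f\in M$ and $\mathrm{enc}(a,b)\in M$ imply $b\in M$. A model of $\mathbf{L}$ is a pair $\langle I,M\rangle$ with $I$ an interpretation and $M$ an $\mathbf{L}$-closed set.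
   Formalization: The set At of atomic infons is assumed countable; for uncountable At completeness fails, because valuations take values in the countable set of words and must identify distinct atoms. *)

theory Defs
  imports "HOL-Library.Countable_Set"
begin

datatype 'a basic = Top | Bot | Atom 'a

datatype (atoms: 'a) infon =
    Basic "'a basic"
  | Conj "'a infon" "'a infon"
  | Imp "'a infon" "'a infon"

definition infons :: "'a set \<Rightarrow> 'a infon set" where
  "infons At = {\<phi>. atoms \<phi> \<subseteq> At}"

datatype infon_logic = P_bot | P_bot_w

(* infers L S \<phi>: the infon \<phi> follows by a single application of a rule of L to members of S *)
inductive infers :: "infon_logic \<Rightarrow> 'a infon set \<Rightarrow> 'a infon \<Rightarrow> bool" for L S where
  conj_intro: "\<phi>\<^sub>1 \<in> S \<Longrightarrow> \<phi>\<^sub>2 \<in> S \<Longrightarrow> infers L S (Conj \<phi>\<^sub>1 \<phi>\<^sub>2)"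
| conj_elim1: "Conj \<phi>\<^sub>1 \<phi>\<^sub>2 \<in> S \<Longrightarrow> infers L S \<phi>\<^sub>1"
| conj_elim2: "Conj \<phi>\<^sub>1 \<phi>\<^sub>2 \<in> S \<Longrightarrow> infers L S \<phi>\<^sub>2"
| imp_intro: "\<phi>\<^sub>2 \<in> S \<Longrightarrow> infers L S (Imp \<phi>\<^sub>1 \<phi>\<^sub>2)"
| imp_elim: "\<phi>\<^sub>1 \<in> S \<Longrightarrow> Imp \<phi>\<^sub>1 \<phi>\<^sub>2 \<in> S \<Longrightarrow> infers L S \<phi>\<^sub>2"
| bot_elim: "L = P_bot \<Longrightarrow> Basic Bot \<in> S \<Longrightarrow> infers L S \<phi>"
| bot_w_elim: "L = P_bot_w \<Longrightarrow> Basic Bot \<in> S \<Longrightarrow> Imp \<phi> \<psi> \<in> S \<Longrightarrow> infers L S \<psi>"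

definition derivation ::
  "infon_logic \<Rightarrow> 'a set \<Rightarrow> 'a infon set \<Rightarrow> 'a infon list \<Rightarrow> bool" where
  "derivation L At \<Gamma> ds \<longleftrightarrow>
     set ds \<subseteq> infons At \<and>
     (\<forall>i<length ds. ds ! i \<in> \<Gamma> \<union> {Basic Top} \<or> infers L (set (take i ds)) (ds ! i))"

definition derives ::
  "infon_logic \<Rightarrow> 'a set \<Rightarrow> 'a infon set \<Rightarrow> 'a infon \<Rightarrow> bool" where
  "derives L At \<Gamma> \<phi> \<longleftrightarrow> (\<exists>ds. derivation L At \<Gamma> ds \<and> ds \<noteq> [] \<and> last ds = \<phi>)"

(* The letters are {0, 1, f}; the element f of an infon algebra is the one-letter word [FF], and
   the words over {0, 1, f} form the whole type word. *)
datatype letter = Zero | One | FF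

type_synonym word = "letter list"

definition Sigma_star :: "word set" where
  "Sigma_star = lists {Zero, One}"

(* A value None of a partial operation means "undefined". The field crack itself is None for
   algebras that do not have this operation. *)
record infon_alg =
  pair :: "word \<Rightarrow> word \<Rightarrow> word"
  lproj :: "word \<Rightarrow> word option"
  rproj :: "word \<Rightarrow> word option"
  enc :: "word \<Rightarrow> word \<Rightarrow> word"
  dec :: "word \<Rightarrow> word \<Rightarrow> word option"
  crack :: "(word \<Rightarrow> word \<Rightarrow> word option) option"
  E_set :: "word set"

definition preserves1 :: "(word \<Rightarrow> word option) \<Rightarrow> bool" where
  "preserves1 g \<longleftrightarrow> (\<forall>x\<in>Sigma_star. \<forall>z. g x = Some z \<longrightarrow> z \<in> Sigma_star)"

definition preserves2 :: "(word \<Rightarrow> word \<Rightarrow> word option) \<Rightarrow> bool" where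
  "preserves2 g \<longleftrightarrow>
     (\<forall>x\<in>Sigma_star. \<forall>y\<in>Sigma_star. \<forall>z. g x y = Some z \<longrightarrow> z \<in> Sigma_star)"

definition infon_algebra :: "infon_logic \<Rightarrow> infon_alg \<Rightarrow> bool" where
  "infon_algebra L A \<longleftrightarrow>
     (\<forall>x y. lproj A (pair A x y) = Some x) \<and>
     (\<forall>x y. rproj A (pair A x y) = Some y) \<and>
     (\<forall>x y. dec A x (enc A x y) = Some y) \<and>
     (\<forall>x\<in>Sigma_star. \<forall>y\<in>Sigma_star. pair A x y \<in> Sigma_star) \<and>
     (\<forall>x\<in>Sigma_star. \<forall>y\<in>Sigma_star. enc A x y \<in> Sigma_star) \<and>
     preserves1 (lproj A) \<and> preserves1 (rproj A) \<and> preserves2 (dec A) \<and>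
     E_set A \<noteq> {} \<and> E_set A \<subseteq> Sigma_star \<and>
     (case L of
        P_bot \<Rightarrow> crack A = None
      | P_bot_w \<Rightarrow> (\<exists>c. crack A = Some c \<and> preserves2 c \<and>
                        (\<forall>a b. c [FF] (enc A a b) = Some b)))"

definition interpretation_of ::
  "infon_logic \<Rightarrow> 'a set \<Rightarrow> infon_alg \<Rightarrow> ('a basic \<Rightarrow> word) \<Rightarrow> bool" where
  "interpretation_of L At A v \<longleftrightarrow>
     infon_algebra L A \<and> v Bot = [FF] \<and> v Top \<in> E_set A \<and>
     (\<forall>p\<in>At. v (Atom p) \<in> Sigma_star)"

primrec eval_infon :: "infon_alg \<Rightarrow> ('a basic \<Rightarrow> word) \<Rightarrow> 'a infon \<Rightarrow> word" where
  "eval_infon A v (Basic p) = v p"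
| "eval_infon A v (Conj \<phi>\<^sub>1 \<phi>\<^sub>2) = pair A (eval_infon A v \<phi>\<^sub>1) (eval_infon A v \<phi>\<^sub>2)"
| "eval_infon A v (Imp \<phi>\<^sub>1 \<phi>\<^sub>2) = enc A (eval_infon A v \<phi>\<^sub>1) (eval_infon A v \<phi>\<^sub>2)"

definition closed_for :: "infon_logic \<Rightarrow> infon_alg \<Rightarrow> word set \<Rightarrow> bool" where
  "closed_for L A M \<longleftrightarrow>
     E_set A \<subseteq> M \<and>
     (\<forall>a b. a \<in> M \<and> b \<in> M \<longleftrightarrow> pair A a b \<in> M) \<and>
     (\<forall>a b. a \<in> M \<and> enc A a b \<in> M \<longrightarrow> b \<in> M) \<and>
     (\<forall>a b. b \<in> M \<longrightarrow> enc A a b \<in> M) \<and>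
     (case L of
        P_bot \<Rightarrow> [FF] \<in> M \<longrightarrow> M = UNIV
      | P_bot_w \<Rightarrow> (\<forall>a b. [FF] \<in> M \<and> enc A a b \<in> M \<longrightarrow> b \<in> M))"

definition is_model ::
  "infon_logic \<Rightarrow> 'a set \<Rightarrow> infon_alg \<Rightarrow> ('a basic \<Rightarrow> word) \<Rightarrow> word set \<Rightarrow> bool" where
  "is_model L At A v M \<longleftrightarrow> interpretation_of L At A v \<and> closed_for L A M"

end

theory Submission
  imports Defs
begin

text \<open>Soundness is an induction on the position in a derivation. For completeness, one algebra and
  one valuation \<open>v\<close> serve all \<open>\<Gamma>\<close>: infons are written as words in a self-delimiting prefix notation,
  and a total map \<open>read\<close> from words to infons is a homomorphism on all words, meaningless words
  included, with \<open>read (v \<phi>) = \<phi>\<close>. Hence the set of words \<open>w\<close> such that \<open>\<Gamma>\<close> derives \<open>read w\<close> is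
  closed and meets the words of the form \<open>v \<phi>\<close> exactly in the consequences of \<open>\<Gamma>\<close>.\<close>

section \<open>Derivations\<close>

lemma infers_mono:
  assumes "infers L S \<phi>" and "S \<subseteq> T"
  shows "infers L T \<phi>"
  using assms by (induction rule: infers.induct) (auto intro: infers.intros)

lemma derivation_Nil: "derivation L At \<Gamma> []"
  by (simp add: derivation_def)

text \<open>The justification of an entry refers only to earlier entries, so derivations can be
  built and analysed from the right end, as the inductions by \<open>rev_induct\<close> do.\<close>

lemma derivation_snoc:
  "derivation L At \<Gamma> (ds @ [\<phi>]) \<longleftrightarrow>
     derivation L At \<Gamma> ds \<and> \<phi> \<in> infons At \<and> (\<phi> \<in> \<Gamma> \<union> {Basic Top} \<or> infers L (set ds) \<phi>)"
  by (auto simp: derivation_def nth_append less_Suc_eq)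

lemma derivation_append:
  assumes "derivation L At \<Gamma> ds" and "derivation L At \<Gamma> es"
  shows "derivation L At \<Gamma> (ds @ es)"
  using assms(2)
proof (induction es rule: rev_induct)
  case Nil
  then show ?case using assms(1) by simp
next
  case (snoc \<phi> es)
  have "infers L (set es) \<phi> \<Longrightarrow> infers L (set (ds @ es)) \<phi>"
    by (erule infers_mono) simp
  then have "derivation L At \<Gamma> ((ds @ es) @ [\<phi>])"
    using snoc by (auto simp only: derivation_snoc)
  then show ?case by simp
qed

text \<open>Cutting a derivation right after an occurrence of \<open>\<phi>\<close> leaves a
  derivation that ends in \<open>\<phi>\<close>.\<close>

lemma derives_iff_mem:
  "derives L At \<Gamma> \<phi> \<longleftrightarrow> (\<exists>ds. derivation L At \<Gamma> ds \<and> \<phi> \<in> set ds)"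
proof
  assume "derives L At \<Gamma> \<phi>"
  then show "\<exists>ds. derivation L At \<Gamma> ds \<and> \<phi> \<in> set ds"
    by (auto simp: derives_def)
next
  assume "\<exists>ds. derivation L At \<Gamma> ds \<and> \<phi> \<in> set ds"
  then obtain ds where "derivation L At \<Gamma> ds" "\<phi> \<in> set ds" by blast
  then show "derives L At \<Gamma> \<phi>"
  proof (induction ds rule: rev_induct)
    case (snoc \<psi> ds)
    then show ?case
      by (cases "\<phi> = \<psi>") (auto simp: derivation_snoc derives_def intro!: exI[of _ "ds @ [\<psi>]"])
  qed simp
qed

lemma derives_assumption:
  assumes "\<phi> \<in> \<Gamma> \<union> {Basic Top}" and "\<phi> \<in> infons At"
  shows "derives L At \<Gamma> \<phi>"
  using assms derivation_snoc[of L At \<Gamma> "[]" \<phi>]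
  by (auto simp: derives_def derivation_Nil intro!: exI[of _ "[\<phi>]"])

text \<open>Derivations of the finitely many premises are concatenated and \<open>\<phi>\<close> is
  appended. Membership in \<open>infons At\<close> is asked for because \<open>imp_intro\<close> and
  \<open>bot_elim\<close> can bring in foreign atoms.\<close>

lemma derives_infers:
  assumes "finite S" and "\<And>\<psi>. \<psi> \<in> S \<Longrightarrow> derives L At \<Gamma> \<psi>"
    and "infers L S \<phi>" and "\<phi> \<in> infons At"
  shows "derives L At \<Gamma> \<phi>"
proof -
  have "\<exists>ds. derivation L At \<Gamma> ds \<and> S \<subseteq> set ds"
    using assms(1,2)
  proof (induction S rule: finite_induct)
    case empty
    then show ?case using derivation_Nil by blast
  next
    case (insert \<psi> S)
    then obtain ds es where "derivation L At \<Gamma> ds" "S \<subseteq> set ds"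
      and "derivation L At \<Gamma> es" "\<psi> \<in> set es"
      by (metis derives_iff_mem insertCI)
    then show ?case
      by (intro exI[of _ "ds @ es"]) (auto intro: derivation_append)
  qed
  then obtain ds where "derivation L At \<Gamma> ds" "S \<subseteq> set ds" by blast
  then have "derivation L At \<Gamma> (ds @ [\<phi>])"
    using assms(3,4) infers_mono[of L S \<phi> "set ds"] by (simp add: derivation_snoc)
  then show ?thesis by (auto simp: derives_def)
qed

section \<open>Soundness\<close>

lemma closed_for_D:
  assumes "closed_for L A M"
  shows "pair A x y \<in> M \<longleftrightarrow> x \<in> M \<and> y \<in> M"
    and "x \<in> M \<Longrightarrow> enc A x y \<in> M \<Longrightarrow> y \<in> M"
    and "y \<in> M \<Longrightarrow> enc A x y \<in> M"
  using assms unfolding closed_for_def by blast+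

lemma closed_for_botD:
  "closed_for P_bot A M \<Longrightarrow> [FF] \<in> M \<Longrightarrow> x \<in> M"
  "closed_for P_bot_w A M \<Longrightarrow> [FF] \<in> M \<Longrightarrow> enc A x y \<in> M \<Longrightarrow> y \<in> M"
  unfolding closed_for_def infon_logic.case by blast+

lemma infers_sound:
  assumes "infers L S \<phi>" and "eval_infon A v ` S \<subseteq> M" and "closed_for L A M" and "v Bot = [FF]"
  shows "eval_infon A v \<phi> \<in> M"
proof -
  have mem: "eval_infon A v \<psi> \<in> M" if "\<psi> \<in> S" for \<psi>
    using assms(2) that by blast
  note closed = closed_for_D[OF assms(3)]
  from assms(1) show ?thesis
  proof cases
    case (conj_intro \<phi>\<^sub>1 \<phi>\<^sub>2)
    then show ?thesis by (simp add: closed(1) mem)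
  next
    case (conj_elim1 \<psi>)
    then show ?thesis using mem[of "Conj \<phi> \<psi>"] by (simp add: closed(1))
  next
    case (conj_elim2 \<psi>)
    then show ?thesis using mem[of "Conj \<psi> \<phi>"] by (simp add: closed(1))
  next
    case (imp_intro \<phi>\<^sub>2 \<phi>\<^sub>1)
    then show ?thesis by (simp add: closed(3) mem)
  next
    case (imp_elim \<psi>)
    show ?thesis
      by (rule closed(2)) (use mem imp_elim in force)+
  next
    case bot_elim
    then show ?thesis
      using mem[of "Basic Bot"] assms(3,4) by (auto intro: closed_for_botD(1))
  next
    case (bot_w_elim \<psi>)
    show ?thesis
      by (rule closed_for_botD(2)) (use mem bot_w_elim assms(3,4) in force)+
  qed
qed

lemma derivation_sound:
  assumes "derivation L At \<Gamma> ds" and "is_model L At A v M" and "eval_infon A v ` \<Gamma> \<subseteq> M"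
  shows "eval_infon A v ` set ds \<subseteq> M"
  using assms(1)
proof (induction ds rule: rev_induct)
  case (snoc \<phi> ds)
  \<comment> \<open>An entry \<open>Basic Top\<close> is covered because \<open>v Top\<close> lies
    in \<open>E_set A\<close>, which every closed set contains.\<close>
  have "v Top \<in> M" "v Bot = [FF]" "closed_for L A M"
    using assms(2) unfolding is_model_def interpretation_of_def closed_for_def by blast+
  then show ?case
    using snoc assms(3) infers_sound[of L "set ds" \<phi> A v M] by (auto simp: derivation_snoc)
qed simp

section \<open>The word algebra\<close>

text \<open>The length of \<open>x\<close> in unary, ended by \<open>Zero\<close>, tells where
  \<open>x\<close> stops. This works for arbitrary words, even those containing \<open>FF\<close>,
  and adds no \<open>FF\<close> of its own.\<close>

definition join :: "word \<Rightarrow> word \<Rightarrow> word" where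
  "join x y = replicate (length x) One @ Zero # x @ y"

text \<open>\<open>tl\<close> removes the end marker of the unary prefix; a word of
  \<open>One\<close> letters only yields \<open>[]\<close>.\<close>

definition payload :: "word \<Rightarrow> word" where
  "payload w = tl (dropWhile (\<lambda>c. c = One) w)"

definition join_fst :: "word \<Rightarrow> word" where
  "join_fst w = take (length (takeWhile (\<lambda>c. c = One) w)) (payload w)"

definition join_snd :: "word \<Rightarrow> word" where
  "join_snd w = drop (length (takeWhile (\<lambda>c. c = One) w)) (payload w)"

lemma payload_join: "payload (join x y) = x @ y"
  by (simp add: payload_def join_def dropWhile_append)

lemma length_takeWhile_join: "length (takeWhile (\<lambda>c. c = One) (join x y)) = length x"
  by (simp add: join_def takeWhile_append)

lemma join_fst_join [simp]: "join_fst (join x y) = x"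
  and join_snd_join [simp]: "join_snd (join x y) = y"
  by (simp_all add: join_fst_def join_snd_def payload_join length_takeWhile_join)

lemma length_payload: "length (payload w) \<le> length w"
  using length_dropWhile_le[of "\<lambda>c. c = One" w] by (simp add: payload_def)

text \<open>The bounds hold for all words, not only for values of \<open>join\<close>; the
  termination of \<open>read\<close> rests on them.\<close>

lemma length_join_fst: "length (join_fst w) \<le> length w"
  and length_join_snd: "length (join_snd w) \<le> length w"
  using length_payload[of w] by (simp_all add: join_fst_def join_snd_def)

lemma Sigma_star_iff: "w \<in> Sigma_star \<longleftrightarrow> set w \<subseteq> {Zero, One}"
  by (auto simp: Sigma_star_def)

lemma set_payload: "set (payload w) \<subseteq> set w"
  unfolding payload_def by (metis list.set_sel(2) set_dropWhileD subsetI tl_Nil)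

lemma Sigma_star_join_fst: "w \<in> Sigma_star \<Longrightarrow> join_fst w \<in> Sigma_star"
  and Sigma_star_join_snd: "w \<in> Sigma_star \<Longrightarrow> join_snd w \<in> Sigma_star"
  using set_payload[of w] set_take_subset set_drop_subset
  unfolding Sigma_star_iff join_fst_def join_snd_def by (meson subset_trans)+

lemma Sigma_star_join: "x \<in> Sigma_star \<Longrightarrow> y \<in> Sigma_star \<Longrightarrow> join x y \<in> Sigma_star"
  by (auto simp: Sigma_star_iff join_def)

lemma Sigma_star_drop: "w \<in> Sigma_star \<Longrightarrow> drop n w \<in> Sigma_star"
  unfolding Sigma_star_iff using set_drop_subset by (meson subset_trans)

text \<open>Two tag letters tell pairs from encryptions. Decoding ignores the key, so
  \<open>crack\<close> can use the same function as \<open>dec\<close>.\<close>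

definition word_alg :: "infon_logic \<Rightarrow> infon_alg" where
  "word_alg L = \<lparr>
     pair = (\<lambda>x y. Zero # Zero # join x y),
     lproj = (\<lambda>w. Some (join_fst (drop 2 w))),
     rproj = (\<lambda>w. Some (join_snd (drop 2 w))),
     enc = (\<lambda>x y. Zero # One # join x y),
     dec = (\<lambda>x w. Some (join_snd (drop 2 w))),
     crack = (case L of P_bot \<Rightarrow> None | P_bot_w \<Rightarrow> Some (\<lambda>x w. Some (join_snd (drop 2 w)))),
     E_set = {[]} \<rparr>"

lemma infon_algebra_word_alg: "infon_algebra L (word_alg L)"
proof -
  have "[] \<in> Sigma_star" "\<And>c w. c # w \<in> Sigma_star \<longleftrightarrow> c \<noteq> FF \<and> w \<in> Sigma_star"
    using letter.exhaust by (auto simp: Sigma_star_iff)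
  then show ?thesis
    by (simp add: infon_algebra_def word_alg_def preserves1_def preserves2_def Sigma_star_join
          Sigma_star_join_fst Sigma_star_join_snd Sigma_star_drop
        split: infon_logic.split)
qed

text \<open>Atoms get nonempty unary words, distinct from \<open>[]\<close>, from
  \<open>[FF]\<close> and from tagged words, which start with \<open>Zero\<close>.\<close>

definition word_val :: "'a set \<Rightarrow> 'a basic \<Rightarrow> word" where
  "word_val At b = (case b of Top \<Rightarrow> [] | Bot \<Rightarrow> [FF]
     | Atom p \<Rightarrow> One # replicate (to_nat_on At p) One)"

lemma interpretation_of_word_val: "interpretation_of L At (word_alg L) (word_val At)"
  by (auto simp: interpretation_of_def infon_algebra_word_alg)
    (auto simp: word_alg_def word_val_def Sigma_star_iff)

text \<open>The test keeps the result inside \<open>At\<close> even if \<open>At\<close> is empty; a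
  number that codes no atom is read as \<open>Top\<close>.\<close>

definition decode_atom :: "'a set \<Rightarrow> nat \<Rightarrow> 'a basic" where
  "decode_atom At n =
     (if n \<in> to_nat_on At ` At then Atom (from_nat_into At n) else Top)"

text \<open>The first two equations accept any \<open>w\<close> after the tag, so words that are not
  values of infons are read as well. The last two patterns, which no infon produces, default to
  \<open>Top\<close>.\<close>

function read :: "'a set \<Rightarrow> word \<Rightarrow> 'a infon" where
  "read At (Zero # Zero # w) = Conj (read At (join_fst w)) (read At (join_snd w))"
| "read At (Zero # One # w) = Imp (read At (join_fst w)) (read At (join_snd w))"
| "read At (One # w) = Basic (decode_atom At (length w))"
| "read At (FF # w) = Basic Bot"
| "read At [] = Basic Top"
| "read At [Zero] = Basic Top"
| "read At (Zero # FF # w) = Basic Top"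
  by pat_completeness auto
termination
  \<comment> \<open>Dropping the two tag letters makes the decrease in length strict.\<close>
  by (relation "measure (length \<circ> snd)")
    (auto simp: less_Suc_eq_le intro: le_SucI length_join_fst length_join_snd)

lemma read_in_infons:
  fixes At :: "'a set"
  shows "read At w \<in> infons At"
proof (induction At w rule: read.induct)
  case (3 At w)
  have "decode_atom At n = Top \<or> (\<exists>p\<in>At. decode_atom At n = Atom p)" for n
    using from_nat_into[of At n] by (auto simp: decode_atom_def)
  then have "set_basic (decode_atom At (length w)) \<subseteq> At"
    by (metis basic.set(1,3) empty_subsetI insert_subset)
  then show ?case by (simp add: infons_def)
qed (auto simp: infons_def)

lemma read_pair: "read At (pair (word_alg L) x y) = Conj (read At x) (read At y)"
  and read_enc: "read At (enc (word_alg L) x y) = Imp (read At x) (read At y)"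
  by (simp_all add: word_alg_def)

text \<open>Countability makes \<open>to_nat_on At\<close> injective on \<open>At\<close>, so an
  atom is recovered from its unary code; the connectives follow from the homomorphism
  equations.\<close>

lemma read_eval:
  assumes "countable At" and "\<phi> \<in> infons At"
  shows "read At (eval_infon (word_alg L) (word_val At) \<phi>) = \<phi>"
  using assms(2)
proof (induction \<phi>)
  case (Basic b)
  then show ?case
    using assms(1)
    by (cases b) (auto simp: word_val_def decode_atom_def infons_def)
qed (simp_all add: infons_def read_pair read_enc)

section \<open>Completeness\<close>

text \<open>The closure clauses range over all words. Since \<open>read\<close> turns
  \<open>pair\<close> and \<open>enc\<close> into connectives everywhere, each clause becomes an
  instance of rules of \<open>L\<close>.\<close>

lemma closed_for_derivable:
  "closed_for L (word_alg L) {w. derives L At \<Gamma> (read At w)}"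
proof -
  \<comment> \<open>Listing the premises makes them finite in number, and
    \<open>read_in_infons\<close> allows any word as the conclusion.\<close>
  have infer: "derives L At \<Gamma> (read At w)"
    if "infers L (set \<psi>s) (read At w)" "\<forall>\<psi>\<in>set \<psi>s. derives L At \<Gamma> \<psi>" for \<psi>s w
    using derives_infers[of "set \<psi>s" L At \<Gamma> "read At w"] that read_in_infons by auto
  have top: "E_set (word_alg L) \<subseteq> {w. derives L At \<Gamma> (read At w)}"
    by (auto simp: word_alg_def infons_def intro: derives_assumption)
  have conj: "derives L At \<Gamma> (read At x) \<and> derives L At \<Gamma> (read At y) \<longleftrightarrow>
      derives L At \<Gamma> (read At (pair (word_alg L) x y))" for x y
    using infer[of "[read At x, read At y]" "pair (word_alg L) x y"]
      infer[of "[read At (pair (word_alg L) x y)]" x]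
      infer[of "[read At (pair (word_alg L) x y)]" y]
    by (auto simp: read_pair intro: infers.intros)
  have mp: "derives L At \<Gamma> (read At y)"
    if "derives L At \<Gamma> (read At x)" "derives L At \<Gamma> (read At (enc (word_alg L) x y))" for x y
    using that infer[of "[read At x, Imp (read At x) (read At y)]" y]
    by (auto simp: read_enc intro: infers.imp_elim)
  have imp: "derives L At \<Gamma> (read At (enc (word_alg L) x y))"
    if "derives L At \<Gamma> (read At y)" for x y
    using that infer[of "[read At y]" "enc (word_alg L) x y"]
    by (auto simp: read_enc intro: infers.imp_intro)
  have bot: "derives L At \<Gamma> (read At y)" if "L = P_bot" "derives L At \<Gamma> (Basic Bot)" for y
    using that infer[of "[Basic Bot]" y] by (auto intro: infers.bot_elim)
  have bot_w: "derives L At \<Gamma> (read At y)"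
    if "L = P_bot_w" "derives L At \<Gamma> (Basic Bot)"
      "derives L At \<Gamma> (read At (enc (word_alg L) x y))" for x y
    using that infer[of "[Basic Bot, Imp (read At x) (read At y)]" y]
    by (auto simp: read_enc intro: infers.bot_w_elim)
  \<comment> \<open>The falsity clause: \<open>[FF]\<close> is read as \<open>Basic Bot\<close>,
    whose derivability under \<open>P_bot\<close> puts every word into the set.\<close>
  have "case L of
      P_bot \<Rightarrow> derives L At \<Gamma> (read At [FF]) \<longrightarrow> {w. derives L At \<Gamma> (read At w)} = UNIV
    | P_bot_w \<Rightarrow> \<forall>x y. derives L At \<Gamma> (read At [FF]) \<and>
        derives L At \<Gamma> (read At (enc (word_alg L) x y)) \<longrightarrow> derives L At \<Gamma> (read At y)"
  proof (cases L)
    case P_bot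
    then show ?thesis using bot by auto
  next
    case P_bot_w
    then show ?thesis
      unfolding P_bot_w infon_logic.case read.simps using bot_w[OF P_bot_w, unfolded P_bot_w] by blast
  qed
  moreover have "\<forall>x y. derives L At \<Gamma> (read At x) \<and>
      derives L At \<Gamma> (read At (enc (word_alg L) x y)) \<longrightarrow> derives L At \<Gamma> (read At y)"
    using mp by blast
  ultimately show ?thesis
    unfolding closed_for_def mem_Collect_eq using top conj imp by (intro conjI) blast+
qed

theorem theorem3:
  fixes L :: infon_logic and At :: "'a set" and \<Gamma> :: "'a infon set" and \<phi> :: "'a infon"
  assumes "countable At" and "\<Gamma> \<subseteq> infons At" and "\<phi> \<in> infons At"
  shows "derives L At \<Gamma> \<phi> \<longleftrightarrow>
    (\<forall>A v M. is_model L At A v M \<and> eval_infon A v ` \<Gamma> \<subseteq> M \<longrightarrow> eval_infon A v \<phi> \<in> M)"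
proof (intro iffI allI impI)
  fix A v M
  assume "derives L At \<Gamma> \<phi>" and "is_model L At A v M \<and> eval_infon A v ` \<Gamma> \<subseteq> M"
  then show "eval_infon A v \<phi> \<in> M"
    using derivation_sound[of L At \<Gamma> _ A v M] by (auto simp: derives_iff_mem)
next
  let ?A = "word_alg L" and ?v = "word_val At" and ?M = "{w. derives L At \<Gamma> (read At w)}"
  assume valid:
    "\<forall>A v M. is_model L At A v M \<and> eval_infon A v ` \<Gamma> \<subseteq> M \<longrightarrow> eval_infon A v \<phi> \<in> M"
  have "is_model L At ?A ?v ?M"
    by (simp add: is_model_def interpretation_of_word_val closed_for_derivable)
  \<comment> \<open>Reading undoes evaluation, so the value of \<open>\<psi>\<close> is in
    \<open>?M\<close> as soon as \<open>\<psi>\<close> is derivable; the same cancellation finally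
    turns membership of the value of \<open>\<phi>\<close> into a derivation.\<close>
  moreover have "eval_infon ?A ?v \<psi> \<in> ?M" if "\<psi> \<in> \<Gamma>" for \<psi>
    using that assms(1,2) read_eval[of At \<psi> L] derives_assumption[of \<psi> \<Gamma> At L] by auto
  ultimately have "eval_infon ?A ?v \<phi> \<in> ?M"
    using valid[rule_format, of ?A ?v ?M] by blast
  then show "derives L At \<Gamma> \<phi>"
    using assms(1,3) by (simp add: read_eval)
qed

end
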